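(* Let $m\ge2$, $s\ge 2$, $2\le w<r<\overline{n}=2m$, $\overline{k}=\overline{n}-r$, $\overline{d}=\overline{k}+w-1$, $N=w^m$, $n=s\overline{n}$, $k=n-r$, and let $\mathcal{C}_1$ be the $(n,k)$ array code over $\mathbf{F}_q$ with sub-packetization level $N$ and parity-check matrix $(A_{t,i})_{t\in[0:r),i\in[0:n)}$, $A_{t,i}=x_i^t\,\overline{A}_{t,\bar i}$, where $x_i\in\mathbf{F}_q\setminus\{0\}$, $\bar i=i\%\overline{n}$, and $$\overline{A}_{t,i}=\begin{cases}\sum\limits_{a=0}^{N-1}\lambda_{i,a_i}^te_a^\top e_a+\sum\limits_{a\in[0:N),\,a_i=0}\ \sum\limits_{u=1}^{w-1}(\lambda_{i,0}^t-\lambda_{i,u}^t)e_a^\top e_{a(i,u)}, & i\in[0:m),\\ \sum\limits_{a=0}^{N-1}\lambda_{i,a_{i-m}}^te_a^\top e_a,& i\in[m:\overline{n}),\end{cases}$$ with $\lambda_{i,u}\in\mathbf{F}_q$ ($i\in[0:\overline n)$, $u\in[0:w)$). Then $\mathcal{C}_1$ is an MDS array code with the $(d=n-\overline{n}+\overline{d},\,d_c=s-1)$-repair property and $\bigl(1+\frac{d_c(d-k)}{d}\bigr)$-optimal repair bandwidth (with the repair matrices $R_{i,j}$ given in the context) if the following conditions hold, where $\bar i=i\%\overline{n}$, $\bar j=j\%\overline{n}$: i) $x_i\lambda_{\bar i,u}\ne x_j\lambda_{\bar j,u'}$ for $u,u'\in[0:w)$ and $i,j\in[0:n)$ with $i\not\equiv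 j\bmod m$; ii) $x_i\lambda_{\bar i,u}\ne x_j\lambda_{\bar j,u}$ for $u\in[0:w)$ and $i,j\in[0:n)$ with $i\ne j$ and $i\equiv j\bmod m$; iii) $\lambda_{\bar i,u}\ne\lambda_{\bar i,u'}$ for $u,u'\in[0:w)$ with $u\ne u'$ and $\bar i\in[0:\overline{n})$; iv) $x_i\lambda_{\bar i,0}\ne x_j\lambda_{\bar j,u}$ for $u\in[1:w)$ and $i,j\in[0:n)$ with $i\equiv j\bmod m$ and $i\not\equiv j\bmod\overline{n}$.
   Context: Notation: $[a:b)=\{a,\dots,b-1\}$; $\%$ is the modulo operation; $y^0=1$ for all $y\in\mathbf{F}_q$. $e_0,\dots,e_{N-1}$ are the standard basis row vectors of $\mathbf{F}_q^N$, $N=w^m$. For $a\in[0:N)$, $(a_0,\dots,a_{m-1})$ is its $w$-ary expansion, $a=\sum_{j=0}^{m-1}w^{m-1-j}a_j$, and $a(i,u)$ is the integer obtained from $a$ by replacing the digit $a_i$ by $u$. For $i\in[0:m)$, $u\in[0:w)$, $V_{i,u}$ is the $w^{m-1}\times w^m$ matrix whose rows are the vectors $e_a$ with $a_i=u$, in ascending order of $a$; for $i\in[m:2m)$, $V_{i,u}=V_{i-m,u}$. Array codes: an $(n,k)$ array code with parity-check matrix $(A_{t,i})_{t\in[0:r),i\in[0:n)}$ ($r=n-k$, $A_{t,i}\in\mathbf{F}_q^{N\times N}$) is the set of $(\mathbf{f}_0,\dots,\mathbf{f}_{n-1})$, $\mathbf{f}_i\in\mathbf{F}_q^N$ columns,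 with $\sum_{i}A_{t,i}\mathbf{f}_i=0$ for all $t\in[0:r)$. It is MDS if every $r\times r$ sub-block matrix $(A_{t,i_j})_{t,j\in[0:r)}$, $i_0<\dots<i_{r-1}$, is non-singular (any $k$ nodes determine the codeword). Repair matrices of $\mathcal{C}_1$: $R_{i,j}=I_N$ if $j\equiv i\bmod\overline{n}$; otherwise $R_{i,j}=V_{\bar i,0}$ if $\bar i\in[0:m)$, and $R_{i,j}=V_{\bar i,0}+V_{\bar i,1}+\dots+V_{\bar i,w-1}$ if $\bar i\in[m:\overline{n})$. $(d,d_c)$-repair property with $(1+\epsilon)$-optimal repair bandwidth: for every node $i$ and every $d$-subset $H_i\subseteq[0:n)\setminus\{i\}$ containing the $d_c=s-1$ compulsory helper nodes $\{j\ne i: j\equiv i\bmod\overline{n}\}$, $\mathbf{f}_i$ can be recovered from the data $R_{i,j}\mathbf{f}_j$, $j\in H_i$, and the repair bandwidth satisfies $\gamma_i=\sum_{j\in H_i}\operatorname{rank}(R_{i,j})\le(1+\epsilon)\frac{d}{d-k+1}N$. *)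

theory Defs
  imports
    "HOL-Library.FuncSet"
    "Jordan_Normal_Form.Determinant"
    "Jordan_Normal_Form.DL_Rank"
begin

subsection \<open>Array codes given by block parity-check matrices\<close>

text \<open>\<open>A t i\<close> is the \<open>N \<times> N\<close> block of the parity-check matrix in block row \<open>t\<close> and block
  column \<open>i\<close>. Codewords are \<open>n\<close>-tuples of column vectors, hence extensional functions.\<close>

definition array_code ::
    "nat \<Rightarrow> nat \<Rightarrow> nat \<Rightarrow> (nat \<Rightarrow> nat \<Rightarrow> 'a::field mat) \<Rightarrow> (nat \<Rightarrow> 'a vec) set" where
  "array_code n k N A =
     {f \<in> {..<n} \<rightarrow>\<^sub>E carrier_vec N.
        \<forall>t<n - k. finsum_vec TYPE('a) N (\<lambda>i. A t i *\<^sub>v f i) {..<n} = 0\<^sub>v N}"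

definition sub_block_matrix ::
    "nat \<Rightarrow> nat \<Rightarrow> (nat \<Rightarrow> nat \<Rightarrow> 'a::field mat) \<Rightarrow> (nat \<Rightarrow> nat) \<Rightarrow> 'a mat" where
  "sub_block_matrix r N A idx =
     mat (r * N) (r * N)
       (\<lambda>(p, c). A (p div N) (idx (c div N)) $$ (p mod N, c mod N))"

definition is_MDS :: "nat \<Rightarrow> nat \<Rightarrow> nat \<Rightarrow> (nat \<Rightarrow> nat \<Rightarrow> 'a::field mat) \<Rightarrow> bool" where
  "is_MDS n k N A \<longleftrightarrow>
     (\<forall>idx. strict_mono_on {..<n - k} idx \<and> idx ` {..<n - k} \<subseteq> {..<n} \<longrightarrow>
        det (sub_block_matrix (n - k) N A idx) \<noteq> 0)"

subsection \<open>Repair\<close>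

definition compulsory_helpers :: "nat \<Rightarrow> nat \<Rightarrow> nat \<Rightarrow> nat set" where
  "compulsory_helpers n nbar i = {j. j < n \<and> j \<noteq> i \<and> j mod nbar = i mod nbar}"

definition admissible_helpers :: "nat \<Rightarrow> nat \<Rightarrow> nat \<Rightarrow> nat \<Rightarrow> nat set set" where
  "admissible_helpers n nbar d i =
     {H. H \<subseteq> {..<n} - {i} \<and> card H = d \<and> compulsory_helpers n nbar i \<subseteq> H}"

text \<open>Node \<open>i\<close> is a function of the downloaded data \<open>R i j *\<^sub>v f j\<close>, \<open>j \<in> H\<close>;
  the function depends on \<open>i\<close> and \<open>H\<close> but not on the codeword.\<close>

definition recoverable ::
    "(nat \<Rightarrow> 'a::field vec) set \<Rightarrow> (nat \<Rightarrow> nat \<Rightarrow> 'a mat) \<Rightarrow> nat \<Rightarrow> nat set \<Rightarrow> bool" where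
  "recoverable C R i H \<longleftrightarrow>
     (\<exists>dec :: (nat \<Rightarrow> 'a vec) \<Rightarrow> 'a vec. \<forall>f\<in>C. f i = dec (\<lambda>j\<in>H. R i j *\<^sub>v f j))"

definition mat_rank :: "'a::field mat \<Rightarrow> nat" where
  "mat_rank M = vec_space.rank (dim_row M) M"

definition repair_bandwidth :: "(nat \<Rightarrow> nat \<Rightarrow> 'a::field mat) \<Rightarrow> nat \<Rightarrow> nat set \<Rightarrow> nat" where
  "repair_bandwidth R i H = (\<Sum>j\<in>H. mat_rank (R i j))"

definition repair_property ::
    "nat \<Rightarrow> nat \<Rightarrow> nat \<Rightarrow> nat \<Rightarrow> (nat \<Rightarrow> 'a::field vec) set \<Rightarrow> (nat \<Rightarrow> nat \<Rightarrow> 'a mat) \<Rightarrow> bool" where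
  "repair_property n nbar d dc C R \<longleftrightarrow>
     (\<forall>i<n. card (compulsory_helpers n nbar i) = dc \<and>
        (\<forall>H\<in>admissible_helpers n nbar d i. recoverable C R i H))"

definition near_optimal_bandwidth ::
    "nat \<Rightarrow> nat \<Rightarrow> nat \<Rightarrow> nat \<Rightarrow> nat \<Rightarrow> real \<Rightarrow> (nat \<Rightarrow> nat \<Rightarrow> 'a::field mat) \<Rightarrow> bool" where
  "near_optimal_bandwidth n k nbar N d eps R \<longleftrightarrow>
     (\<forall>i<n. \<forall>H\<in>admissible_helpers n nbar d i.
        real (repair_bandwidth R i H)
          \<le> (1 + eps) * (real d / (real d - real k + 1)) * real N)"

subsection \<open>The code \<open>C\<^sub>1\<close>\<close>

text \<open>Digits are indexed from the most significant one: \<open>a = (\<Sum>j<m. w ^ (m - 1 - j) * a\<^sub>j)\<close>.\<close>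

definition digit :: "nat \<Rightarrow> nat \<Rightarrow> nat \<Rightarrow> nat \<Rightarrow> nat" where
  "digit w m a j = (a div w ^ (m - 1 - j)) mod w"

definition set_digit :: "nat \<Rightarrow> nat \<Rightarrow> nat \<Rightarrow> nat \<Rightarrow> nat \<Rightarrow> nat" where
  "set_digit w m a i u = a - w ^ (m - 1 - i) * digit w m a i + w ^ (m - 1 - i) * u"

text \<open>The entry of \<open>e\<^sub>a\<^sup>T e\<^sub>b\<close> in row \<open>p\<close> and column \<open>c\<close>. Since \<open>'a mat\<close> is not an additive
  monoid, the matrix sums below are written entrywise.\<close>

definition e_entry :: "nat \<Rightarrow> nat \<Rightarrow> nat \<Rightarrow> nat \<Rightarrow> nat \<Rightarrow> 'a::field" where
  "e_entry N a b p c = unit_vec N a $ p * unit_vec N b $ c"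

definition A_bar :: "nat \<Rightarrow> nat \<Rightarrow> (nat \<Rightarrow> nat \<Rightarrow> 'a::field) \<Rightarrow> nat \<Rightarrow> nat \<Rightarrow> 'a mat" where
  "A_bar m w lam t i =
     (let N = w ^ m in
      if i < m then
        mat N N (\<lambda>(p, c).
          (\<Sum>a<N. lam i (digit w m a i) ^ t * e_entry N a a p c)
          + (\<Sum>a | a < N \<and> digit w m a i = 0.
               \<Sum>u=1..<w. (lam i 0 ^ t - lam i u ^ t) * e_entry N a (set_digit w m a i u) p c))
      else
        mat N N (\<lambda>(p, c).
          \<Sum>a<N. lam i (digit w m a (i - m)) ^ t * e_entry N a a p c))"

definition C1_parity ::
    "nat \<Rightarrow> nat \<Rightarrow> (nat \<Rightarrow> 'a::field) \<Rightarrow> (nat \<Rightarrow> nat \<Rightarrow> 'a) \<Rightarrow> nat \<Rightarrow> nat \<Rightarrow> 'a mat" where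
  "C1_parity m w x lam t i = x i ^ t \<cdot>\<^sub>m A_bar m w lam t (i mod (2 * m))"

definition V_mat :: "nat \<Rightarrow> nat \<Rightarrow> nat \<Rightarrow> nat \<Rightarrow> 'a::field mat" where
  "V_mat m w i u =
     (let i' = (if i < m then i else i - m) in
      mat_of_rows (w ^ m)
        (map (unit_vec (w ^ m)) (filter (\<lambda>a. digit w m a i' = u) [0..<w ^ m])))"

definition C1_repair :: "nat \<Rightarrow> nat \<Rightarrow> nat \<Rightarrow> nat \<Rightarrow> 'a::field mat" where
  "C1_repair m w i j =
     (let nbar = 2 * m; ibar = i mod nbar in
      if j mod nbar = i mod nbar then 1\<^sub>m (w ^ m)
      else if ibar < m then V_mat m w ibar 0
      else mat (w ^ (m - 1)) (w ^ m) (\<lambda>(p, c). \<Sum>u<w. V_mat m w ibar u $$ (p, c)))"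

end

theory Submission
  imports Defs
begin

text \<open>In the parity checks indexed by \<open>a\<close>, the non-diagonal terms of a node involve only indices
  \<open>a(i, u)\<close> with \<open>a\<^sub>i = 0 \<noteq> u\<close>, which have fewer zero digits than \<open>a\<close>. By induction on the number of
  zero digits they vanish, and what remains for a fixed \<open>a\<close> is a Vandermonde system in \<open>t\<close> with nodes
  \<open>x\<^sub>i \<lambda>\<close>. Applied to \<open>r\<close> columns of the parity-check matrix this is the MDS property.

  For repair, consider the difference of two codewords with equal downloaded data; it vanishes on the
  compulsory helpers. With \<open>g = i mod m\<close>, restrict the checks to \<open>a\<^sub>g = 0\<close> if node \<open>i\<close> is of the
  non-diagonal type, and sum them over all values of the digit \<open>a\<^sub>g\<close> otherwise. Either way the data of
  the helpers cancel, node \<open>i\<close> contributes \<open>w\<close> unknowns with nodes \<open>x\<^sub>i \<lambda>(i, u)\<close>, and each of the \<open>r - w\<close>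
  nodes not contacted contributes one, so the same triangular Vandermonde argument applies.\<close>

subsection \<open>Vandermonde systems\<close>

text \<open>The coefficients of the polynomial \<open>p\<close> that vanishes at every node except
  \<open>c j\<close> combine the equations into \<open>poly p (c j) * y j = 0\<close>. The degree of
  \<open>p\<close> is at most \<open>card I - 1\<close>, hence below \<open>r\<close>, and
  distinctness of the nodes makes the factor nonzero.\<close>

lemma vandermonde_kernel_trivial:
  fixes c y :: "'i \<Rightarrow> 'a::field"
  assumes fin: "finite I" and inj: "inj_on c I" and card: "card I \<le> r"
    and eq: "\<And>t. t < r \<Longrightarrow> (\<Sum>i\<in>I. c i ^ t * y i) = 0"
    and j: "j \<in> I"
  shows "y j = 0"
proof -
  define p where "p = (\<Prod>i\<in>I - {j}. [:- c i, 1:])"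
  have "Polynomial.degree p \<le> sum (Polynomial.degree \<circ> (\<lambda>i. [:- c i, 1:])) (I - {j})"
    unfolding p_def by (rule degree_prod_sum_le) (use fin in auto)
  also have "\<dots> = card I - 1"
    using fin j by simp
  also have "\<dots> < r"
    using card j fin card_gt_0_iff[of I] by fastforce
  finally have deg: "Polynomial.degree p < r" .
  have "(\<Sum>i\<in>I. poly p (c i) * y i)
      = (\<Sum>i\<in>I. \<Sum>t\<le>Polynomial.degree p. Polynomial.coeff p t * (c i ^ t * y i))"
    by (simp add: poly_altdef sum_distrib_right mult.assoc)
  also have "\<dots> = (\<Sum>t\<le>Polynomial.degree p. Polynomial.coeff p t * (\<Sum>i\<in>I. c i ^ t * y i))"
    by (subst sum.swap) (simp add: sum_distrib_left)
  also have "\<dots> = 0"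
    using deg by (intro sum.neutral ballI) (simp add: eq)
  finally have "(\<Sum>i\<in>I. poly p (c i) * y i) = 0" .
  moreover have "(\<Sum>i\<in>I. poly p (c i) * y i) = poly p (c j) * y j"
  proof -
    have "poly p (c i) = 0" if "i \<in> I - {j}" for i
      unfolding p_def poly_prod using that fin by (auto intro!: prod_zero bexI[of _ i])
    then show ?thesis
      by (simp add: sum.remove[OF fin j])
  qed
  moreover have "poly p (c j) \<noteq> 0"
    unfolding p_def poly_prod using fin inj j by (auto simp: prod_zero_iff inj_on_def)
  ultimately show ?thesis by simp
qed

text \<open>In repair, the unknowns of the nodes not contacted and those of the failed node have
  different index sets; the disjoint sum merges them into one system.\<close>

lemma vandermonde_kernel_trivial_Plus:
  fixes c y :: "'i \<Rightarrow> 'a::field" and b z :: "'j \<Rightarrow> 'a"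
  assumes fin: "finite U" "finite W" and inj: "inj_on c U" "inj_on b W"
    and disj: "\<And>i j. i \<in> U \<Longrightarrow> j \<in> W \<Longrightarrow> c i \<noteq> b j"
    and card: "card U + card W \<le> r"
    and eq: "\<And>t. t < r \<Longrightarrow> (\<Sum>i\<in>U. c i ^ t * y i) + (\<Sum>j\<in>W. b j ^ t * z j) = 0"
  shows "(\<forall>i\<in>U. y i = 0) \<and> (\<forall>j\<in>W. z j = 0)"
proof -
  have inj': "inj_on (case_sum c b) (U <+> W)"
    unfolding inj_on_def using inj disj by (force simp: inj_on_def)
  have "case_sum y z p = 0" if "p \<in> U <+> W" for p
  proof (rule vandermonde_kernel_trivial[OF _ inj' _ _ that])
    show "card (U <+> W) \<le> r" using fin card by (simp add: card_Plus)
    show "(\<Sum>i\<in>U <+> W. case_sum c b i ^ t * case_sum y z i) = 0" if "t < r" for t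
      using eq[OF that] fin by (simp add: sum.Plus)
  qed (use fin in auto)
  then show ?thesis
    by (metis InlI InrI sum.case)
qed

text \<open>Systems that are Vandermonde at each \<open>a\<close> up to unknowns \<open>G i a'\<close> with \<open>\<mu> a' < \<mu> a\<close>; the
  \<open>z j a\<close> are unknowns that occur at \<open>a\<close> only.\<close>

lemma triangular_vandermonde:
  fixes G c :: "'i \<Rightarrow> 'b \<Rightarrow> 'a::field" and b :: "'j \<Rightarrow> 'a" and z :: "'j \<Rightarrow> 'b \<Rightarrow> 'a"
    and \<mu> :: "'b \<Rightarrow> nat"
  assumes fin: "finite U" "finite W"
    and inj: "\<And>a. a \<in> T \<Longrightarrow> inj_on (\<lambda>i. c i a) U" "inj_on b W"
    and disj: "\<And>a i j. a \<in> T \<Longrightarrow> i \<in> U \<Longrightarrow> j \<in> W \<Longrightarrow> c i a \<noteq> b j"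
    and card: "card U + card W \<le> r"
    and eq: "\<And>a t. \<lbrakk>a \<in> T; t < r; \<And>i a'. \<lbrakk>i \<in> U; a' \<in> T; \<mu> a' < \<mu> a\<rbrakk> \<Longrightarrow> G i a' = 0\<rbrakk>
      \<Longrightarrow> (\<Sum>i\<in>U. c i a ^ t * G i a) + (\<Sum>j\<in>W. b j ^ t * z j a) = 0"
    and "a \<in> T"
  shows "(\<forall>i\<in>U. G i a = 0) \<and> (\<forall>j\<in>W. z j a = 0)"
  using \<open>a \<in> T\<close>
proof (induction "\<mu> a" arbitrary: a rule: less_induct)
  case less
  show ?case
    by (rule vandermonde_kernel_trivial_Plus[OF fin inj disj card])
       (use less in \<open>auto intro!: eq\<close>)
qed

subsection \<open>Digits\<close>

text \<open>Splits \<open>a\<close> into the part above digit \<open>i\<close>, the digit itself and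
  the part below. This form is free of subtraction, so that quotients and remainders can be read
  off.\<close>

lemma set_digit_alt:
  "set_digit w m a i u
    = a div (w * w ^ (m - 1 - i)) * (w * w ^ (m - 1 - i)) + w ^ (m - 1 - i) * u
      + a mod w ^ (m - 1 - i)"
proof -
  let ?e = "w ^ (m - 1 - i)"
  have "a = a div (w * ?e) * (w * ?e) + (?e * (a div ?e mod w) + a mod ?e)"
    by (metis mod_mult2_eq mult.commute div_mult_mod_eq)
  then show ?thesis
    unfolding set_digit_def digit_def by linarith
qed

lemma set_digit_less:
  assumes "a < w ^ m" "i < m" "u < w"
  shows "set_digit w m a i u < w ^ m"
proof -
  let ?e = "w ^ (m - 1 - i)"
  have pos: "0 < ?e" using assms by simp
  \<comment> \<open>There are \<open>i\<close> digits above digit \<open>i\<close>, so the part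
    above it is less than \<open>w ^ i\<close>.\<close>
  have "w ^ m = w ^ (i + Suc (m - 1 - i))"
    using assms(2) by simp
  then have split: "w ^ m = w ^ i * (w * ?e)"
    unfolding power_add power_Suc .
  have "a div (w * ?e) < w ^ i"
    using assms(1) unfolding split by (rule less_mult_imp_div_less)
  then have "(a div (w * ?e) + 1) * (w * ?e) \<le> w ^ i * (w * ?e)"
    by (intro mult_right_mono) auto
  moreover have "?e * (u + 1) \<le> ?e * w"
    using assms(3) by (intro mult_left_mono) auto
  moreover have "a mod ?e < ?e"
    using pos by simp
  ultimately show ?thesis
    unfolding set_digit_alt split by (simp add: algebra_simps)
qed

lemma digit_less: "0 < w \<Longrightarrow> digit w m a i < w"
  by (simp add: digit_def)

lemma digit_set_digit_same:
  assumes "u < w"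
  shows "digit w m (set_digit w m a i u) i = u"
proof -
  let ?e = "w ^ (m - 1 - i)"
  have pos: "?e \<noteq> 0" using assms by simp
  have "set_digit w m a i u = a mod ?e + (a div (w * ?e) * w + u) * ?e"
    unfolding set_digit_alt by (simp add: algebra_simps)
  then have "set_digit w m a i u div ?e = (a div (w * ?e) * w + u) + a mod ?e div ?e"
    by (simp only: div_mult_self1[OF pos])
  then have "set_digit w m a i u div ?e = a div (w * ?e) * w + u"
    using pos by simp
  then show ?thesis
    using assms by (simp add: digit_def)
qed

text \<open>Digit 0 is the most significant one. For \<open>j < i\<close>, digit \<open>j\<close>
  depends only on the quotient by \<open>w * w ^ (m - 1 - i)\<close>, and the new digit causes no
  carry into it. For \<open>j > i\<close>, it depends only on the remainder modulo
  \<open>w ^ (m - 1 - j) * w\<close>, which divides the weight of digit \<open>i\<close>.\<close>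

lemma digit_set_digit_other:
  assumes "u < w" "i < m" "j < m" "i \<noteq> j"
  shows "digit w m (set_digit w m a i u) j = digit w m a j"
proof (cases "j < i")
  case True
  let ?e = "w ^ (m - 1 - i)"
  have pos: "0 < ?e" using assms by simp
  have less: "?e * u + a mod ?e < w * ?e"
  proof -
    have "?e * u + ?e \<le> ?e * w"
      using assms(1) by (metis Suc_leI add.commute mult_Suc_right mult_le_mono2)
    then show ?thesis
      using mod_less_divisor[OF pos, of a] unfolding mult.commute[of w] by linarith
  qed
  have same: "set_digit w m a i u div (w * ?e) = a div (w * ?e)"
    unfolding set_digit_alt add.assoc using less pos assms(1) by simp
  have "w ^ (m - 1 - j) = w ^ (Suc (m - 1 - i) + (i - 1 - j))"
    using True assms by (intro arg_cong[where f = "power w"]) auto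
  then have e: "w ^ (m - 1 - j) = (w * ?e) * w ^ (i - 1 - j)"
    unfolding power_add power_Suc .
  show ?thesis
    unfolding digit_def e div_mult2_eq[of _ "w * ?e"] same ..
next
  case False
  let ?e = "w ^ (m - 1 - i)" and ?e' = "w ^ (m - 1 - j)"
  have "?e = w ^ (Suc (m - 1 - j) + (j - 1 - i))"
    using False assms by (intro arg_cong[where f = "power w"]) auto
  then have e: "?e = (?e' * w) * w ^ (j - 1 - i)"
    unfolding power_add power_Suc2 .
  then have dvd: "?e' * w dvd ?e" by simp
  have "set_digit w m a i u = (a div (w * ?e) * w + u) * ?e + a mod ?e"
    unfolding set_digit_alt by (simp add: algebra_simps)
  moreover obtain q where "?e = ?e' * w * q"
    using dvd by blast
  ultimately have "set_digit w m a i u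
      = a mod ?e + (a div (w * ?e) * w + u) * q * (?e' * w)"
    by (metis add.commute mult.assoc mult.commute)
  then have "set_digit w m a i u mod (?e' * w) = (a mod ?e) mod (?e' * w)"
    by simp
  also have "\<dots> = a mod (?e' * w)"
    using dvd by (rule mod_mod_cancel)
  finally have same: "set_digit w m a i u mod (?e' * w) = a mod (?e' * w)" .
  have "digit w m b j = b mod (?e' * w) div ?e'" for b
    unfolding digit_def mod_mult2_eq using assms(1) by simp
  then show ?thesis
    using same by simp
qed

lemma digit_set_digit:
  assumes "u < w" "i < m" "j < m"
  shows "digit w m (set_digit w m a i u) j = (if j = i then u else digit w m a j)"
  using assms by (cases "j = i") (simp_all add: digit_set_digit_same digit_set_digit_other)

text \<open>Induction on the number \<open>l\<close> of low-order digits, which determine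
  \<open>a mod w ^ l\<close>. The next digit, of weight \<open>w ^ l\<close>, has index
  \<open>m - 1 - l\<close>.\<close>

lemma digit_eqI:
  assumes "a < w ^ m" "b < w ^ m" "\<And>j. j < m \<Longrightarrow> digit w m a j = digit w m b j"
  shows "a = b"
proof -
  have "l \<le> m \<Longrightarrow> a mod w ^ l = b mod w ^ l" for l
  proof (induction l)
    case (Suc l)
    have "digit w m a (m - 1 - l) = digit w m b (m - 1 - l)"
      using Suc.prems by (intro assms) auto
    then have "a div w ^ l mod w = b div w ^ l mod w"
      using Suc.prems by (simp add: digit_def)
    then show ?case
      using Suc by (simp add: mod_mult2_eq power_Suc2 del: power_Suc)
  qed simp
  from this[of m] show ?thesis
    using assms by simp
qed

lemma set_digit_digit: "set_digit w m a i (digit w m a i) = a"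
proof -
  \<comment> \<open>The truncated subtraction in \<open>set_digit\<close> is therefore
    exact.\<close>
  have "w ^ (m - 1 - i) * digit w m a i \<le> w ^ (m - 1 - i) * (a div w ^ (m - 1 - i))"
    unfolding digit_def by (intro mult_left_mono) auto
  also have "\<dots> \<le> a" by simp
  finally show ?thesis
    unfolding set_digit_def by simp
qed

lemma set_digit_set_digit_same:
  assumes "a < w ^ m" "i < m" "u < w" "v < w"
  shows "set_digit w m (set_digit w m a i u) i v = set_digit w m a i v"
  by (rule digit_eqI[where w = w and m = m]) (use assms in \<open>simp_all add: set_digit_less digit_set_digit\<close>)

lemma set_digit_commute:
  assumes "a < w ^ m" "i < m" "j < m" "u < w" "v < w" "i \<noteq> j"
  shows "set_digit w m (set_digit w m a i u) j v = set_digit w m (set_digit w m a j v) i u"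
  by (rule digit_eqI[where w = w and m = m]) (use assms in \<open>simp_all add: set_digit_less digit_set_digit\<close>)

section \<open>The number of zero digits, the measure of the triangular induction\<close>

definition zero_digits :: "nat \<Rightarrow> nat \<Rightarrow> nat \<Rightarrow> nat" where
  "zero_digits w m a = card {h. h < m \<and> digit w m a h = 0}"

lemma zero_digits_set_digit_less:
  assumes "h < m" "digit w m a h = 0" "0 < u" "u < w"
  shows "zero_digits w m (set_digit w m a h u) < zero_digits w m a"
  unfolding zero_digits_def
proof (rule psubset_card_mono)
  have "{l. l < m \<and> digit w m (set_digit w m a h u) l = 0}
      = {l. l < m \<and> digit w m a l = 0} - {h}"
    using assms by (auto simp: digit_set_digit split: if_splits)
  then show "{l. l < m \<and> digit w m (set_digit w m a h u) l = 0} \<subset> {l. l < m \<and> digit w m a l = 0}"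
    using assms by auto
qed simp

section \<open>Index lists of the rows of \<open>V_mat\<close>\<close>

definition digit_list :: "nat \<Rightarrow> nat \<Rightarrow> nat \<Rightarrow> nat \<Rightarrow> nat list" where
  "digit_list w m i u = filter (\<lambda>a. digit w m a i = u) [0..<w ^ m]"

text \<open>Raising a zero digit to \<open>u\<close> adds a constant, which preserves the ascending
  order, and two strictly increasing lists with the same elements agree. Hence the rows number
  \<open>p\<close> of the matrices \<open>V_mat m w i u\<close>, for varying \<open>u\<close>,
  select indices that differ in digit \<open>i\<close> only.\<close>

lemma digit_list_eq_map:
  assumes "i < m" "u < w"
  shows "digit_list w m i u = map (\<lambda>a. set_digit w m a i u) (digit_list w m i 0)"
proof -
  let ?L = "digit_list w m i 0"
  have shift: "map (\<lambda>a. set_digit w m a i u) ?L = map (\<lambda>a. a + w ^ (m - 1 - i) * u) ?L"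
    unfolding digit_list_def by (auto simp: set_digit_def)
  have sorted: "sorted_wrt (<) (map (\<lambda>a. a + w ^ (m - 1 - i) * u) ?L)"
    unfolding digit_list_def sorted_wrt_map by (simp add: sorted_wrt_filter)
  have set: "set (map (\<lambda>a. set_digit w m a i u) ?L) = set (digit_list w m i u)"
  proof (intro equalityI subsetI)
    fix b assume b: "b \<in> set (digit_list w m i u)"
    then have "b = set_digit w m (set_digit w m b i 0) i u"
      using assms set_digit_digit[of w m b i] by (auto simp: digit_list_def set_digit_set_digit_same)
    moreover have "set_digit w m b i 0 \<in> set ?L"
      using b assms by (auto simp: digit_list_def set_digit_less digit_set_digit)
    ultimately show "b \<in> set (map (\<lambda>a. set_digit w m a i u) ?L)"
      by auto
  qed (use assms in \<open>auto simp: digit_list_def set_digit_less digit_set_digit\<close>)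
  show ?thesis
  proof (rule strict_sorted_equal)
    show "sorted_wrt (<) (digit_list w m i u)"
      by (simp add: digit_list_def sorted_wrt_filter)
    show "sorted_wrt (<) (map (\<lambda>a. set_digit w m a i u) ?L)"
      unfolding shift by (rule sorted)
  qed (rule set[symmetric])
qed

text \<open>The \<open>w\<close> lists for the possible values of the digit partition the
  \<open>w ^ m\<close> indices, and they all have the same length because each is an image of the
  list for 0.\<close>

lemma length_digit_list:
  assumes "i < m" "u < w"
  shows "length (digit_list w m i u) = w ^ (m - 1)"
proof -
  have len: "length (digit_list w m i v) = card {a. a < w ^ m \<and> digit w m a i = v}" for v
    unfolding digit_list_def
    by (subst distinct_card[symmetric]) (auto intro: arg_cong[where f = card])
  have "w ^ m = card (\<Union>v<w. {a. a < w ^ m \<and> digit w m a i = v})"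
  proof -
    have "(\<Union>v<w. {a. a < w ^ m \<and> digit w m a i = v}) = {..<w ^ m}"
      using assms digit_less[of w m] by auto
    then show ?thesis by simp
  qed
  also have "\<dots> = (\<Sum>v<w. length (digit_list w m i v))"
    unfolding len by (rule card_UN_disjoint) auto
  also have "\<dots> = (\<Sum>v<w. length (digit_list w m i u))"
  proof (rule sum.cong[OF refl])
    fix v assume "v \<in> {..<w}"
    then show "length (digit_list w m i v) = length (digit_list w m i u)"
      using digit_list_eq_map[OF assms(1), of v w] digit_list_eq_map[OF assms] by (metis length_map lessThan_iff)
  qed
  finally have "w * w ^ (m - 1) = w * length (digit_list w m i u)"
    using assms(1) by (simp flip: power_Suc)
  then show ?thesis using assms(2) by simp
qed

lemma digit_list_nth:
  assumes "i < m" "u < w" "p < w ^ (m - 1)"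
  shows "digit_list w m i u ! p = set_digit w m (digit_list w m i 0 ! p) i u"
proof -
  have "p < length (digit_list w m i 0)"
    using assms by (simp add: length_digit_list)
  then show ?thesis
    unfolding digit_list_eq_map[OF assms(1,2)] by (rule nth_map)
qed

lemma digit_list_0_nthE:
  assumes "i < m" "0 < w" "a < w ^ m" "digit w m a i = 0"
  obtains p where "p < w ^ (m - 1)" "digit_list w m i 0 ! p = a"
proof -
  have "a \<in> set (digit_list w m i 0)"
    using assms by (simp add: digit_list_def)
  then show thesis
    using that assms length_digit_list[of i m 0 w] by (auto simp: in_set_conv_nth)
qed

lemma digit_list_nth_less:
  assumes "i < m" "u < w" "p < w ^ (m - 1)"
  shows "digit_list w m i u ! p < w ^ m"
proof -
  have "digit_list w m i u ! p \<in> set (digit_list w m i u)"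
    using assms by (simp add: length_digit_list)
  then show ?thesis
    by (simp add: digit_list_def)
qed

lemma V_mat_carrier: "i < m \<Longrightarrow> u < w \<Longrightarrow> V_mat m w i u \<in> carrier_mat (w ^ (m - 1)) (w ^ m)"
  using length_digit_list[of i m u w] by (auto simp: V_mat_def digit_list_def)

lemma index_V_mat:
  assumes "i < 2 * m" "u < w" "p < w ^ (m - 1)" "c < w ^ m"
  shows "V_mat m w i u $$ (p, c) = (if c = digit_list w m (i mod m) u ! p then 1 else 0)"
proof -
  have im: "i mod m < m" using assms by auto
  have i': "(if i < m then i else i - m) = i mod m"
    using assms(1) by (auto simp: mod_if)
  have V: "V_mat m w i u = mat_of_rows (w ^ m) (map (unit_vec (w ^ m)) (digit_list w m (i mod m) u))"
    unfolding V_mat_def i' digit_list_def by simp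
  moreover have "digit_list w m (i mod m) u ! p < w ^ m"
    by (rule digit_list_nth_less[OF im assms(2,3)])
  ultimately show ?thesis
    unfolding V using assms length_digit_list[OF im assms(2)]
    by (simp add: mat_of_rows_def)
qed

text \<open>The rank is the size of a maximal independent set of columns, which live in a space of
  dimension \<open>dim_row M\<close>. This bounds the amount downloaded from each helper.\<close>

lemma mat_rank_le_dim_row: "mat_rank (M :: 'a::field mat) \<le> dim_row M"
proof -
  interpret vec_space "TYPE('a)" "dim_row M" .
  obtain S where S: "maximal S (\<lambda>T. T \<subseteq> set (cols M) \<and> lin_indpt T)"
    using maximal_exists[of "\<lambda>T. T \<subseteq> set (cols M) \<and> lin_indpt T" "card (set (cols M))" "{}"]
    by (meson List.finite_set card_mono empty_iff empty_subsetI finite_lin_indpt2 rev_finite_subset)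
  have M: "M \<in> carrier_mat (dim_row M) (dim_col M)" by simp
  from S have "S \<subseteq> set (cols M)" "lin_indpt S"
    by (auto simp: maximal_def)
  moreover from this have "S \<subseteq> carrier_vec (dim_row M)"
    using cols_dim[of M] by blast
  ultimately have "card S \<le> dim"
    by (intro li_le_dim(2)[OF fin_dim]) simp_all
  then show ?thesis
    unfolding mat_rank_def rank_card_indpt[OF M S] dim_is_n by simp
qed

subsection \<open>Parity checks and the MDS property\<close>

text \<open>The contribution of node \<open>j\<close>, with content \<open>g\<close>, to the parity check \<open>(t, a)\<close>. The digit that
  matters is \<open>j mod m\<close> for both kinds of nodes, since \<open>j mod (2 * m)\<close> is \<open>j mod m\<close> or
  \<open>j mod m + m\<close>.\<close>

definition parity_row ::
    "nat \<Rightarrow> nat \<Rightarrow> (nat \<Rightarrow> 'a::field) \<Rightarrow> (nat \<Rightarrow> nat \<Rightarrow> 'a) \<Rightarrow> nat \<Rightarrow> nat \<Rightarrow> (nat \<Rightarrow> 'a) \<Rightarrow> nat \<Rightarrow> 'a"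
  where
  "parity_row m w x lam t j g a =
     (if j mod (2 * m) < m \<and> digit w m a (j mod m) = 0
      then x j ^ t * (lam (j mod (2 * m)) 0 ^ t * g a
        + (\<Sum>u=1..<w. (lam (j mod (2 * m)) 0 ^ t - lam (j mod (2 * m)) u ^ t)
            * g (set_digit w m a (j mod m) u)))
      else (x j * lam (j mod (2 * m)) (digit w m a (j mod m))) ^ t * g a)"

text \<open>The bit \<open>j div m mod 2\<close> separates the two kinds of nodes.\<close>

lemma mod_double:
  "(j::nat) mod (2 * m) = (if j mod (2 * m) < m then j mod m else j mod m + m)"
proof (cases "m = 0")
  case False
  then have "j mod m < m" by simp
  moreover have "j mod (2 * m) = m * (j div m mod 2) + j mod m"
    using mod_mult2_eq[of j m 2] by (simp add: mult.commute)
  moreover have "j div m mod 2 = 0 \<or> j div m mod 2 = 1" by auto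
  ultimately show ?thesis by auto
qed simp

text \<open>Each \<open>e_entry\<close> is a matrix unit, so in the fixed row \<open>a\<close> only
  the summands with \<open>a' = a\<close> survive.\<close>

lemma index_A_bar_less:
  assumes "i < m" "0 < w" "a < w ^ m" "c < w ^ m"
  shows "A_bar m w lam t i $$ (a, c) =
    (if c = a then lam i (digit w m a i) ^ t else 0)
    + (if digit w m a i = 0
       then \<Sum>u=1..<w. (lam i 0 ^ t - lam i u ^ t) * (if c = set_digit w m a i u then 1 else 0)
       else 0)"
proof -
  have e: "e_entry (w ^ m) a' b a c = (if a' = a then (if c = b then 1 else 0) else 0 :: 'a)"
    if "a' < w ^ m" "b < w ^ m" for a' b
    unfolding e_entry_def using assms that by simp
  have 1: "(\<Sum>a'<w ^ m. lam i (digit w m a' i) ^ t * e_entry (w ^ m) a' a' a c)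
      = (\<Sum>a'<w ^ m. if a' = a then (if c = a then lam i (digit w m a i) ^ t else 0) else 0)"
    by (intro sum.cong) (auto simp: e)
  have 2: "(\<Sum>a' | a' < w ^ m \<and> digit w m a' i = 0.
        \<Sum>u=1..<w. (lam i 0 ^ t - lam i u ^ t) * e_entry (w ^ m) a' (set_digit w m a' i u) a c)
      = (\<Sum>a' | a' < w ^ m \<and> digit w m a' i = 0. if a' = a
          then \<Sum>u=1..<w. (lam i 0 ^ t - lam i u ^ t) * (if c = set_digit w m a i u then 1 else 0)
          else 0)"
    using assms by (intro sum.cong refl) (auto simp: e set_digit_less intro!: sum.cong sum.neutral)
  have "A_bar m w lam t i $$ (a, c)
      = (\<Sum>a'<w ^ m. lam i (digit w m a' i) ^ t * e_entry (w ^ m) a' a' a c)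
        + (\<Sum>a' | a' < w ^ m \<and> digit w m a' i = 0.
          \<Sum>u=1..<w. (lam i 0 ^ t - lam i u ^ t) * e_entry (w ^ m) a' (set_digit w m a' i u) a c)"
    using assms by (simp add: A_bar_def Let_def)
  then show ?thesis
    unfolding 1 2 using assms(3) by simp
qed

lemma index_A_bar_ge:
  assumes "m \<le> i" "a < w ^ m" "c < w ^ m"
  shows "A_bar m w lam t i $$ (a, c) = (if c = a then lam i (digit w m a (i - m)) ^ t else 0)"
proof -
  have "(\<Sum>a'<w ^ m. lam i (digit w m a' (i - m)) ^ t * e_entry (w ^ m) a' a' a c)
      = (\<Sum>a'<w ^ m. if a' = a then (if c = a then lam i (digit w m a (i - m)) ^ t else 0) else 0)"
    using assms by (intro sum.cong) (auto simp: e_entry_def)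
  then show ?thesis
    using assms unfolding A_bar_def Let_def by simp
qed

lemma C1_parity_carrier: "C1_parity m w x lam t j \<in> carrier_mat (w ^ m) (w ^ m)"
  by (simp add: C1_parity_def A_bar_def Let_def)

lemma sum_C1_parity_row:
  assumes "0 < m" "0 < w" "a < w ^ m"
  shows "(\<Sum>c<w ^ m. C1_parity m w x lam t j $$ (a, c) * g c) = parity_row m w x lam t j g a"
proof -
  let ?jb = "j mod (2 * m)" and ?h = "j mod m"
  have "?h < m" using assms by simp
  have entry: "C1_parity m w x lam t j $$ (a, c) = x j ^ t * A_bar m w lam t ?jb $$ (a, c)"
    if "c < w ^ m" for c
    using that assms C1_parity_carrier[of m w x lam t j]
    by (simp add: C1_parity_def A_bar_def Let_def)
  have "(\<Sum>c<w ^ m. C1_parity m w x lam t j $$ (a, c) * g c)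
      = x j ^ t * (\<Sum>c<w ^ m. A_bar m w lam t ?jb $$ (a, c) * g c)"
    by (simp add: entry sum_distrib_left mult.assoc)
  also have "\<dots> = parity_row m w x lam t j g a"
  proof (cases "?jb < m")
    case True
    then have jb: "?jb = ?h" using mod_double[of j m] by simp
    let ?S = "\<lambda>c. \<Sum>u=1..<w. (lam ?h 0 ^ t - lam ?h u ^ t)
        * (if c = set_digit w m a ?h u then 1 else 0)"
    have "(\<Sum>c<w ^ m. A_bar m w lam t ?jb $$ (a, c) * g c)
        = (\<Sum>c<w ^ m. (if c = a then lam ?h (digit w m a ?h) ^ t * g a else 0)
            + (if digit w m a ?h = 0 then ?S c * g c else 0))"
      unfolding jb using assms \<open>?h < m\<close>
      by (intro sum.cong refl) (auto simp: index_A_bar_less distrib_right)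
    also have "\<dots> = lam ?h (digit w m a ?h) ^ t * g a
        + (if digit w m a ?h = 0 then \<Sum>c<w ^ m. ?S c * g c else 0)"
      using assms(3) by (simp add: sum.distrib)
    also have "(\<Sum>c<w ^ m. ?S c * g c)
        = (\<Sum>u=1..<w. (lam ?h 0 ^ t - lam ?h u ^ t) * g (set_digit w m a ?h u))"
    proof -
      \<comment> \<open>After exchanging the sums, each \<open>u\<close> picks out the single column
        \<open>set_digit w m a ?h u\<close>.\<close>
      have "(\<Sum>c<w ^ m. ?S c * g c)
          = (\<Sum>u=1..<w. \<Sum>c<w ^ m. if c = set_digit w m a ?h u
              then (lam ?h 0 ^ t - lam ?h u ^ t) * g (set_digit w m a ?h u) else 0)"
        unfolding sum_distrib_right
        by (subst sum.swap) (intro sum.cong refl, simp)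
      then show ?thesis
        using assms \<open>?h < m\<close> by (simp add: set_digit_less)
    qed
    finally show ?thesis
      using True unfolding parity_row_def jb by (simp add: power_mult_distrib mult.assoc)
  next
    case False
    then have jb: "?jb - m = ?h" using mod_double[of j m] by (metis add_diff_cancel_right')
    have "(\<Sum>c<w ^ m. A_bar m w lam t ?jb $$ (a, c) * g c)
        = (\<Sum>c<w ^ m. if c = a then lam ?jb (digit w m a ?h) ^ t * g a else 0)"
      using assms False by (intro sum.cong refl) (auto simp: index_A_bar_ge jb)
    then show ?thesis
      using False assms(3) unfolding parity_row_def by (simp add: power_mult_distrib mult.assoc)
  qed
  finally show ?thesis .
qed

lemma parity_row_diff:
  "parity_row m w x lam t j (\<lambda>a. g a - h a) a
    = parity_row m w x lam t j g a - parity_row m w x lam t j h a"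
  unfolding parity_row_def by (simp add: sum_subtractf algebra_simps)

lemma parity_row_0:
  assumes "\<And>b. b < w ^ m \<Longrightarrow> g b = 0" "0 < m" "a < w ^ m"
  shows "parity_row m w x lam t j g a = 0"
  unfolding parity_row_def using assms by (auto simp: set_digit_less intro!: sum.neutral)

lemma array_code_parity_row:
  assumes "0 < m" "0 < w" and f: "f \<in> array_code n k (w ^ m) (C1_parity m w x lam)"
    and "t < n - k" "a < w ^ m"
  shows "(\<Sum>j<n. parity_row m w x lam t j (\<lambda>c. f j $ c) a) = 0"
proof -
  let ?A = "\<lambda>j. C1_parity m w x lam t j"
  have fj: "f j \<in> carrier_vec (w ^ m)" if "j < n" for j
    using f that unfolding array_code_def by auto
  have row: "(?A j *\<^sub>v f j) $ a = parity_row m w x lam t j (\<lambda>c. f j $ c) a" if "j < n" for j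
  proof -
    have "(?A j *\<^sub>v f j) $ a = (\<Sum>c<w ^ m. ?A j $$ (a, c) * f j $ c)"
      using fj[OF that] C1_parity_carrier[of m w x lam t j] assms(5)
      by (simp add: scalar_prod_def atLeast0LessThan)
    then show ?thesis
      using sum_C1_parity_row[OF assms(1,2,5)] by metis
  qed
  have "finsum_vec TYPE('a) (w ^ m) (\<lambda>j. ?A j *\<^sub>v f j) {..<n} = 0\<^sub>v (w ^ m)"
    using f assms(4) unfolding array_code_def by blast
  then have "finsum_vec TYPE('a) (w ^ m) (\<lambda>j. ?A j *\<^sub>v f j) {..<n} $ a = 0"
    using assms(5) by simp
  moreover have "finsum_vec TYPE('a) (w ^ m) (\<lambda>j. ?A j *\<^sub>v f j) {..<n} $ a
      = (\<Sum>j<n. (?A j *\<^sub>v f j) $ a)"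
    using fj C1_parity_carrier[of m w x lam t] assms(5)
    by (intro index_finsum_vec) (auto intro!: mult_mat_vec_carrier)
  ultimately show ?thesis
    using row by simp
qed

section \<open>Distinct Vandermonde nodes from the conditions on \<open>x\<close> and
  \<open>lam\<close>\<close>

locale C1_conditions =
  fixes m w n :: nat and x :: "nat \<Rightarrow> 'a::field" and lam :: "nat \<Rightarrow> nat \<Rightarrow> 'a"
  assumes m_pos: "0 < m" and w_ge: "2 \<le> w"
    and x_nz: "\<And>i. i < n \<Longrightarrow> x i \<noteq> 0"
    and cond_i: "\<And>u u' i j. \<lbrakk>u < w; u' < w; i < n; j < n; i mod m \<noteq> j mod m\<rbrakk>
      \<Longrightarrow> x i * lam (i mod (2 * m)) u \<noteq> x j * lam (j mod (2 * m)) u'"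
    and cond_ii: "\<And>u i j. \<lbrakk>u < w; i < n; j < n; i \<noteq> j; i mod m = j mod m\<rbrakk>
      \<Longrightarrow> x i * lam (i mod (2 * m)) u \<noteq> x j * lam (j mod (2 * m)) u"
    and cond_iii: "\<And>i u u'. \<lbrakk>i < 2 * m; u < w; u' < w; u \<noteq> u'\<rbrakk> \<Longrightarrow> lam i u \<noteq> lam i u'"
    and cond_iv: "\<And>u i j. \<lbrakk>0 < u; u < w; i < n; j < n; i mod m = j mod m;
        i mod (2 * m) \<noteq> j mod (2 * m)\<rbrakk>
      \<Longrightarrow> x i * lam (i mod (2 * m)) 0 \<noteq> x j * lam (j mod (2 * m)) u"
begin

lemma w_pos: "0 < w"
  using w_ge by simp

text \<open>The diagonal coefficient of node \<open>j\<close> in the check \<open>(t, a)\<close> is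
  the \<open>t\<close>-th power of this element, which makes it a Vandermonde node.\<close>

definition node :: "nat \<Rightarrow> nat \<Rightarrow> 'a" where
  "node j a = x j * lam (j mod (2 * m)) (digit w m a (j mod m))"

text \<open>If the residues modulo \<open>m\<close> differ, condition i) covers all pairs of digit
  values. If they agree, both nodes read the same digit of \<open>a\<close>, and condition ii)
  applies.\<close>

lemma node_neq:
  assumes "i < n" "j < n" "i \<noteq> j"
  shows "node i a \<noteq> node j a"
  unfolding node_def
  using cond_i cond_ii assms digit_less[OF w_pos] by (cases "i mod m = j mod m") auto

lemma parity_row_eq_node:
  assumes "a < w ^ m" "\<And>u. \<lbrakk>j mod (2 * m) < m; digit w m a (j mod m) = 0; 0 < u; u < w\<rbrakk>
    \<Longrightarrow> g (set_digit w m a (j mod m) u) = 0"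
  shows "parity_row m w x lam t j g a = node j a ^ t * g a"
  unfolding parity_row_def node_def using assms(2)
  by (simp add: power_mult_distrib mult.assoc)

text \<open>Row \<open>t * w ^ m + a\<close> of the sub-block matrix is the check
  \<open>(t, a)\<close>. Grouping the columns into blocks of length \<open>w ^ m\<close> cuts
  \<open>v\<close> into one content vector per selected node.\<close>

lemma sub_block_matrix_kernel:
  assumes v: "v \<in> carrier_vec (r * w ^ m)"
    and Mv: "sub_block_matrix r (w ^ m) (C1_parity m w x lam) idx *\<^sub>v v = 0\<^sub>v (r * w ^ m)"
    and t: "t < r" and a: "a < w ^ m"
  shows "(\<Sum>l<r. parity_row m w x lam t (idx l) (\<lambda>c. v $ (l * w ^ m + c)) a) = 0"
proof -
  let ?N = "w ^ m" and ?A = "C1_parity m w x lam"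
  let ?M = "sub_block_matrix r ?N ?A idx"
  have N: "0 < ?N" using w_pos by simp
  have "(t + 1) * ?N \<le> r * ?N"
    using t by (intro mult_right_mono) auto
  then have p: "t * ?N + a < r * ?N"
    using a by simp
  have "0 = (?M *\<^sub>v v) $ (t * ?N + a)"
    unfolding Mv using p by simp
  also have "\<dots> = (\<Sum>c<r * ?N. ?A t (idx (c div ?N)) $$ (a, c mod ?N) * v $ c)"
    using v p a N by (simp add: scalar_prod_def sub_block_matrix_def atLeast0LessThan)
  also have "\<dots> = (\<Sum>l<r. \<Sum>c=l * ?N..<l * ?N + ?N. ?A t (idx (c div ?N)) $$ (a, c mod ?N) * v $ c)"
    by (rule sum.nat_group[symmetric])
  also have "\<dots> = (\<Sum>l<r. \<Sum>c<?N. ?A t (idx l) $$ (a, c) * v $ (l * ?N + c))"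
  proof (rule sum.cong[OF refl])
    fix l
    show "(\<Sum>c=l * ?N..<l * ?N + ?N. ?A t (idx (c div ?N)) $$ (a, c mod ?N) * v $ c)
        = (\<Sum>c<?N. ?A t (idx l) $$ (a, c) * v $ (l * ?N + c))"
      using N by (subst sum.atLeastLessThan_shift_0) (simp add: atLeast0LessThan)
  qed
  also have "\<dots> = (\<Sum>l<r. parity_row m w x lam t (idx l) (\<lambda>c. v $ (l * ?N + c)) a)"
    by (intro sum.cong refl sum_C1_parity_row m_pos w_pos a)
  finally show ?thesis by simp
qed

theorem is_MDS_C1: "is_MDS n k (w ^ m) (C1_parity m w x lam)"
  unfolding is_MDS_def
proof (intro allI impI notI; elim conjE)
  fix idx
  let ?r = "n - k" and ?N = "w ^ m"
  let ?M = "sub_block_matrix ?r ?N (C1_parity m w x lam) idx"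
  assume idx: "strict_mono_on {..<?r} idx" and sub: "idx ` {..<?r} \<subseteq> {..<n}"
  assume "det ?M = 0"
  moreover have "?M \<in> carrier_mat (?r * ?N) (?r * ?N)"
    by (simp add: sub_block_matrix_def)
  ultimately obtain v where v: "v \<in> carrier_vec (?r * ?N)" "v \<noteq> 0\<^sub>v (?r * ?N)"
    and Mv: "?M *\<^sub>v v = 0\<^sub>v (?r * ?N)"
    using det_0_iff_vec_prod_zero_field by metis
  have inj: "inj_on idx {..<?r}"
    using idx by (rule strict_mono_on_imp_inj_on)
  \<comment> \<open>All unknowns belong to the first family of the triangular system; the second
    family is empty.\<close>
  let ?G = "\<lambda>l c. v $ (l * ?N + c)"
  have zero: "(\<forall>l\<in>{..<?r}. ?G l a = 0) \<and> (\<forall>u\<in>{}::nat set. (0::'a) = 0)" if "a \<in> {..<?N}" for a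
  proof (rule triangular_vandermonde[where c = "\<lambda>l. node (idx l)" and b = "\<lambda>_::nat. 0"
        and \<mu> = "zero_digits w m", OF _ _ _ _ _ _ _ that])
    show "inj_on (\<lambda>l. node (idx l) a) {..<?r}" for a
      using inj sub node_neq unfolding inj_on_def by (metis image_subset_iff lessThan_iff)
    fix a t assume a: "a \<in> {..<?N}" and t: "t < ?r"
      and IH: "\<And>l a'. \<lbrakk>l \<in> {..<?r}; a' \<in> {..<?N}; zero_digits w m a' < zero_digits w m a\<rbrakk>
        \<Longrightarrow> ?G l a' = 0"
    have "(\<Sum>l<?r. node (idx l) a ^ t * ?G l a)
        = (\<Sum>l<?r. parity_row m w x lam t (idx l) (?G l) a)"
      using a m_pos
      by (intro sum.cong refl parity_row_eq_node[symmetric] IH)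
        (auto simp: set_digit_less intro!: zero_digits_set_digit_less)
    then show "(\<Sum>l<?r. node (idx l) a ^ t * ?G l a) + (\<Sum>u\<in>{}. 0 ^ t * 0) = 0"
      using sub_block_matrix_kernel[OF v(1) Mv t] a by simp
  qed auto
  have "v = 0\<^sub>v (?r * ?N)"
  proof (rule eq_vecI)
    fix c assume "c < dim_vec (0\<^sub>v (?r * ?N) :: 'a vec)"
    then have "c < ?r * ?N" by simp
    then have "c div ?N < ?r" "c mod ?N < ?N"
      using w_pos by (simp_all add: less_mult_imp_div_less)
    then have "v $ (c div ?N * ?N + c mod ?N) = 0"
      using zero[of "c mod ?N"] by blast
    then have "v $ c = 0"
      unfolding div_mult_mod_eq .
    then show "v $ c = 0\<^sub>v (?r * ?N) $ c"
      using \<open>c < ?r * ?N\<close> by simp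
  qed (use v in simp)
  with v show False by simp
qed

subsection \<open>Repair\<close>

text \<open>What remains of node \<open>j\<close> in the equations used to repair node \<open>i\<close>: if \<open>j \<equiv> i (mod m)\<close> its
  non-diagonal terms drop out, because the digit \<open>i mod m\<close> of \<open>a\<close> is zero and \<open>j\<close> is of diagonal
  type, or because they cancel in the sum over that digit.\<close>

definition reduced_row :: "nat \<Rightarrow> nat \<Rightarrow> nat \<Rightarrow> (nat \<Rightarrow> 'a) \<Rightarrow> nat \<Rightarrow> 'a" where
  "reduced_row i t j g a =
     (if j mod m = i mod m then (x j * lam (j mod (2 * m)) 0) ^ t * g a
      else parity_row m w x lam t j g a)"

text \<open>The descent stays inside \<open>T i\<close>: a node \<open>j\<close> with
  \<open>j mod m = i mod m\<close> has no non-diagonal terms left in its reduced row, and the others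
  change a digit different from \<open>i mod m\<close>. Helpers vanish on \<open>T i\<close>, so the
  nodes outside \<open>H\<close> and the \<open>w\<close> unknowns of node \<open>i\<close> form a
  system with at most \<open>r\<close> unknowns at each \<open>a\<close>.\<close>

lemma reduced_system_kernel:
  fixes G :: "nat \<Rightarrow> nat \<Rightarrow> 'a" and z :: "nat \<Rightarrow> nat \<Rightarrow> 'a"
  defines "T \<equiv> \<lambda>i. {a. a < w ^ m \<and> digit w m a (i mod m) = 0}"
    and "J \<equiv> \<lambda>i. {j. j < n \<and> j mod (2 * m) \<noteq> i mod (2 * m)}"
  assumes i: "i < n" and card: "card (J i - H) + w \<le> r"
    and H0: "\<And>j a. \<lbrakk>j \<in> J i \<inter> H; a \<in> T i\<rbrakk> \<Longrightarrow> G j a = 0"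
    and eq: "\<And>a t. \<lbrakk>a \<in> T i; t < r\<rbrakk> \<Longrightarrow> (\<Sum>j\<in>J i. reduced_row i t j (G j) a)
      + (\<Sum>u<w. (x i * lam (i mod (2 * m)) u) ^ t * z u a) = 0"
    and a: "a \<in> T i" and u: "u < w"
  shows "z u a = 0"
proof -
  let ?U = "J i - H"
  have fin: "finite (J i)" unfolding J_def by simp
  have T: "set_digit w m a' h v \<in> T i"
    if "a' \<in> T i" "h < m" "h \<noteq> i mod m" "v < w" for a' h v
    using that m_pos unfolding T_def by (simp add: set_digit_less digit_set_digit)
  have reduced_0: "reduced_row i t j (G j) a' = 0" if "j \<in> J i \<inter> H" "a' \<in> T i" for j t a'
    using that T H0 m_pos unfolding reduced_row_def parity_row_def
    by (auto intro!: sum.neutral)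
  have "(\<forall>j\<in>?U. G j a = 0) \<and> (\<forall>u\<in>{..<w}. z u a = 0)"
  proof (rule triangular_vandermonde[where c = node and T = "T i" and r = r
        and b = "\<lambda>u. x i * lam (i mod (2 * m)) u" and \<mu> = "zero_digits w m", OF _ _ _ _ _ _ _ a])
    show "inj_on (\<lambda>j. node j a') ?U" for a'
      using node_neq unfolding inj_on_def J_def by blast
    \<comment> \<open>Condition iii) together with \<open>x i \<noteq> 0\<close> separates the
      unknowns of node \<open>i\<close> from each other.\<close>
    show "inj_on (\<lambda>u. x i * lam (i mod (2 * m)) u) {..<w}"
      using cond_iii[of "i mod (2 * m)"] x_nz[OF i] m_pos unfolding inj_on_def by auto
    show "node j a' \<noteq> x i * lam (i mod (2 * m)) u"
      if "a' \<in> T i" "j \<in> ?U" "u \<in> {..<w}" for a' j u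
    proof (cases "j mod m = i mod m")
      case True
      \<comment> \<open>Since the digit \<open>i mod m\<close> of \<open>a'\<close> is 0, node
        \<open>j\<close> carries \<open>x j * lam (j mod (2 * m)) 0\<close>. Condition ii) separates
        it from the case \<open>u = 0\<close>, condition iv) from \<open>u > 0\<close>.\<close>
      have "j < n" "j \<noteq> i" "j mod (2 * m) \<noteq> i mod (2 * m)" "u < w"
        using that unfolding J_def by auto
      then show ?thesis
        using True that(1) cond_ii[of 0 j i] cond_iv[of u j i] i w_pos
        unfolding node_def T_def by (cases "u = 0") auto
    next
      case False
      then show ?thesis
        using cond_i that i digit_less[OF w_pos] unfolding node_def J_def by auto
    qed
    fix a' t assume a': "a' \<in> T i" and t: "t < r"
      and IH: "\<And>j b. \<lbrakk>j \<in> ?U; b \<in> T i; zero_digits w m b < zero_digits w m a'\<rbrakk> \<Longrightarrow> G j b = 0"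
    have "reduced_row i t j (G j) a' = node j a' ^ t * G j a'" if j: "j \<in> ?U" for j
    proof (cases "j mod m = i mod m")
      case True
      then show ?thesis
        using a' unfolding reduced_row_def node_def T_def by simp
    next
      case False
      then have "parity_row m w x lam t j (G j) a' = node j a' ^ t * G j a'"
        using a' m_pos j
        by (intro parity_row_eq_node IH T zero_digits_set_digit_less) (auto simp: T_def)
      then show ?thesis
        using False unfolding reduced_row_def by simp
    qed
    moreover have "(\<Sum>j\<in>J i. reduced_row i t j (G j) a') = (\<Sum>j\<in>?U. reduced_row i t j (G j) a')"
      using fin reduced_0 a' by (intro sum.mono_neutral_right) auto
    ultimately show "(\<Sum>j\<in>?U. node j a' ^ t * G j a')
        + (\<Sum>u<w. (x i * lam (i mod (2 * m)) u) ^ t * z u a') = 0"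
      using eq[OF a' t] by simp
  qed (use fin card in auto)
  with u show ?thesis by simp
qed

lemma sum_nodes_split:
  fixes F :: "nat \<Rightarrow> 'a"
  assumes "i < n" "\<And>j. \<lbrakk>j < n; j \<noteq> i; j mod (2 * m) = i mod (2 * m)\<rbrakk> \<Longrightarrow> F j = 0"
  shows "(\<Sum>j<n. F j) = (\<Sum>j | j < n \<and> j mod (2 * m) \<noteq> i mod (2 * m). F j) + F i"
proof -
  have "(\<Sum>j<n. F j) = (\<Sum>j\<in>insert i {j. j < n \<and> j mod (2 * m) \<noteq> i mod (2 * m)}. F j)"
    using assms by (intro sum.mono_neutral_right) auto
  then show ?thesis by (simp add: add.commute)
qed

lemma sum_lessThan_split_0: "(\<Sum>u<w. f u) = f 0 + (\<Sum>u=1..<w. f u :: 'a)"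
proof -
  have "{..<w} = insert 0 {1..<w}" using w_pos by auto
  then show ?thesis by simp
qed

text \<open>Every \<open>b\<close> is recovered from its variant with digit \<open>i\<close> reset
  to 0 by restoring that digit.\<close>

lemma eq_0_if_digit_variants_eq_0:
  assumes "i < m" "b < w ^ m"
    "\<And>a u. \<lbrakk>a < w ^ m; digit w m a i = 0; u < w\<rbrakk> \<Longrightarrow> g (set_digit w m a i u) = 0"
  shows "g b = 0"
proof -
  have "g (set_digit w m (set_digit w m b i 0) i (digit w m b i)) = 0"
    using assms(1,2) w_pos by (intro assms(3)) (auto simp: set_digit_less digit_set_digit digit_less)
  then show ?thesis
    using assms(1,2) w_pos by (simp add: set_digit_set_digit_same digit_less set_digit_digit)
qed

text \<open>Only checks with digit \<open>i mod m\<close> equal to 0 are used, since helpers outside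
  the residue class of \<open>i\<close> reveal their content exactly there. In these checks the
  other nodes with the same residue modulo \<open>m\<close> are of diagonal type and carry the value
  for digit 0.\<close>

lemma repair_kernel_lower:
  assumes i: "i < n" "i mod (2 * m) < m"
    and card: "card ({j. j < n \<and> j mod (2 * m) \<noteq> i mod (2 * m)} - H) + w \<le> r"
    and eq: "\<And>t a. \<lbrakk>t < r; a < w ^ m\<rbrakk> \<Longrightarrow> (\<Sum>j<n. parity_row m w x lam t j (g j) a) = 0"
    and same: "\<And>j a. \<lbrakk>j < n; j \<noteq> i; j mod (2 * m) = i mod (2 * m); a < w ^ m\<rbrakk> \<Longrightarrow> g j a = 0"
    and other: "\<And>j a. \<lbrakk>j \<in> H; j mod (2 * m) \<noteq> i mod (2 * m); a < w ^ m; digit w m a (i mod m) = 0\<rbrakk>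
      \<Longrightarrow> g j a = 0"
    and b: "b < w ^ m"
  shows "g i b = 0"
proof -
  let ?h = "i mod m" and ?ib = "i mod (2 * m)"
  have h: "?h < m" using m_pos by simp
  \<comment> \<open>Collecting the contribution of node \<open>i\<close> by powers of
    \<open>lam\<close>: the power of \<open>lam (i mod (2 * m)) 0\<close> multiplies the sum of all
    digit variants, and that of \<open>lam (i mod (2 * m)) u\<close> with \<open>u > 0\<close>
    multiplies minus the variant for \<open>u\<close>.\<close>
  define z where "z = (\<lambda>u a. if u = 0 then \<Sum>v<w. g i (set_digit w m a ?h v)
    else - g i (set_digit w m a ?h u))"
  have z: "z u a = 0" if a: "a < w ^ m" "digit w m a ?h = 0" and u: "u < w" for u a
  proof (rule reduced_system_kernel[where G = g and z = z, OF i(1) card _ _ _ u])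
    fix a t assume "a \<in> {a. a < w ^ m \<and> digit w m a ?h = 0}" and t: "t < r"
    then have a: "a < w ^ m" "digit w m a ?h = 0" by auto
    have "parity_row m w x lam t j (g j) a = reduced_row i t j (g j) a"
      if "j mod (2 * m) \<noteq> ?ib" for j
      using that a i(2) mod_double[of j m] mod_double[of i m]
      unfolding reduced_row_def parity_row_def by (auto split: if_splits)
    moreover have "parity_row m w x lam t i (g i) a = (\<Sum>u<w. (x i * lam ?ib u) ^ t * z u a)"
    proof -
      have "set_digit w m a ?h 0 = a"
        using a(2) set_digit_digit[of w m a ?h] by simp
      then show ?thesis
        using a i(2) unfolding parity_row_def sum_lessThan_split_0 z_def
        by (simp add: power_mult_distrib sum_distrib_left sum_subtractf sum_negf algebra_simps)
    qed
    moreover have "parity_row m w x lam t j (g j) a = 0"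
      if "j < n" "j \<noteq> i" "j mod (2 * m) = ?ib" for j
      using same[OF that] m_pos a by (intro parity_row_0) auto
    ultimately show "(\<Sum>j | j < n \<and> j mod (2 * m) \<noteq> ?ib. reduced_row i t j (g j) a)
        + (\<Sum>u<w. (x i * lam ?ib u) ^ t * z u a) = 0"
      using eq[OF t a(1)] sum_nodes_split[OF i(1), of "\<lambda>j. parity_row m w x lam t j (g j) a"]
      by simp
  qed (use other a in auto)
  show ?thesis
  proof (rule eq_0_if_digit_variants_eq_0[OF h b])
    fix a u assume a: "a < w ^ m" "digit w m a ?h = 0" and u: "u < w"
    \<comment> \<open>The unknowns with \<open>u > 0\<close> give these variants directly; the sum
      stored at \<open>u = 0\<close> then leaves only the variant for digit 0.\<close>
    have pos: "g i (set_digit w m a ?h v) = 0" if "0 < v" "v < w" for v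
      using z[OF a that(2)] that unfolding z_def by simp
    have "(\<Sum>v<w. g i (set_digit w m a ?h v)) = 0"
      using z[OF a w_pos] unfolding z_def by simp
    then have "g i (set_digit w m a ?h 0) = 0"
      unfolding sum_lessThan_split_0 using pos by simp
    with pos u show "g i (set_digit w m a ?h u) = 0"
      by (cases "u = 0") auto
  qed
qed

text \<open>If \<open>j mod m = i mod m\<close>, then \<open>j\<close> is of non-diagonal type. The
  check with digit 0 contributes \<open>lam 0 ^ t - lam u ^ t\<close> times the variant for
  \<open>u\<close>, the check with digit \<open>u\<close> contributes \<open>lam u ^ t\<close> times
  it, and the total telescopes to \<open>lam 0 ^ t\<close> times the sum of the variants (with
  \<open>lam\<close> taken at node \<open>j\<close>). Otherwise changing digit
  \<open>i mod m\<close> commutes with the changes made by node \<open>j\<close>, so the summation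
  passes through \<open>parity_row\<close>.\<close>

lemma sum_parity_rows_eq_reduced_row:
  assumes i: "\<not> i mod (2 * m) < m" and j: "j mod (2 * m) \<noteq> i mod (2 * m)"
    and a: "a < w ^ m" "digit w m a (i mod m) = 0"
  shows "(\<Sum>v<w. parity_row m w x lam t j g (set_digit w m a (i mod m) v))
    = reduced_row i t j (\<lambda>a. \<Sum>v<w. g (set_digit w m a (i mod m) v)) a"
proof (cases "j mod m = i mod m")
  case True
  let ?h = "i mod m"
  have h: "?h < m" using m_pos by simp
  have jb: "j mod (2 * m) < m" "j mod (2 * m) = ?h"
    using True i j mod_double[of j m] mod_double[of i m] by (auto split: if_splits)
  let ?s = "\<lambda>u. g (set_digit w m a ?h u)"
  have row0: "parity_row m w x lam t j g (set_digit w m a ?h 0)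
      = x j ^ t * (lam ?h 0 ^ t * ?s 0 + (\<Sum>u=1..<w. (lam ?h 0 ^ t - lam ?h u ^ t) * ?s u))"
    using True jb a h w_pos unfolding parity_row_def
    by (simp add: digit_set_digit set_digit_set_digit_same)
  have row: "parity_row m w x lam t j g (set_digit w m a ?h v) = x j ^ t * lam ?h v ^ t * ?s v"
    if "v \<in> {1..<w}" for v
    using that True jb a h unfolding parity_row_def
    by (simp add: digit_set_digit power_mult_distrib)
  show ?thesis
    unfolding reduced_row_def sum_lessThan_split_0 row0
    using True row jb
    by (simp add: power_mult_distrib sum_distrib_left sum_subtractf algebra_simps)
next
  case False
  let ?h = "i mod m" and ?l = "j mod m"
  have h: "?h < m" "?l < m" using m_pos by simp_all
  let ?s = "\<lambda>a. \<Sum>v<w. g (set_digit w m a ?h v)"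
  have digit: "digit w m (set_digit w m a ?h v) ?l = digit w m a ?l" if "v < w" for v
    using that h False by (simp add: digit_set_digit)
  have commute: "set_digit w m (set_digit w m a ?h v) ?l u = set_digit w m (set_digit w m a ?l u) ?h v"
    if "u < w" "v < w" for u v
    using that h False a by (intro set_digit_commute) auto
  show ?thesis
  proof (cases "j mod (2 * m) < m \<and> digit w m a ?l = 0")
    case True
    let ?d = "\<lambda>u. lam (j mod (2 * m)) 0 ^ t - lam (j mod (2 * m)) u ^ t"
    have "(\<Sum>v<w. parity_row m w x lam t j g (set_digit w m a ?h v))
        = (\<Sum>v<w. x j ^ t * (lam (j mod (2 * m)) 0 ^ t * g (set_digit w m a ?h v)
            + (\<Sum>u=1..<w. ?d u * g (set_digit w m (set_digit w m a ?l u) ?h v))))"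
      unfolding parity_row_def using True by (simp add: digit commute)
    also have "\<dots> = x j ^ t * (lam (j mod (2 * m)) 0 ^ t * ?s a
        + (\<Sum>v<w. \<Sum>u=1..<w. ?d u * g (set_digit w m (set_digit w m a ?l u) ?h v)))"
      by (simp add: sum.distrib flip: sum_distrib_left)
    also have "(\<Sum>v<w. \<Sum>u=1..<w. ?d u * g (set_digit w m (set_digit w m a ?l u) ?h v))
        = (\<Sum>u=1..<w. ?d u * ?s (set_digit w m a ?l u))"
      by (subst sum.swap) (simp add: sum_distrib_left)
    finally show ?thesis
      using True \<open>?l \<noteq> ?h\<close> unfolding reduced_row_def parity_row_def by simp
  next
    case 2: False
    then show ?thesis
      using \<open>?l \<noteq> ?h\<close> unfolding reduced_row_def parity_row_def
      by (auto simp: digit sum_distrib_left)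
  qed
qed

text \<open>Node \<open>i\<close> is of diagonal type, so in the sum of the checks over the digit
  its \<open>w\<close> variants stay separate, one for each \<open>lam (i mod (2 * m)) u\<close>.
  The other nodes enter only through their digit sums \<open>G\<close>, which is what the helpers
  reveal.\<close>

lemma repair_kernel_upper:
  assumes i: "i < n" "\<not> i mod (2 * m) < m"
    and card: "card ({j. j < n \<and> j mod (2 * m) \<noteq> i mod (2 * m)} - H) + w \<le> r"
    and eq: "\<And>t a. \<lbrakk>t < r; a < w ^ m\<rbrakk> \<Longrightarrow> (\<Sum>j<n. parity_row m w x lam t j (g j) a) = 0"
    and same: "\<And>j a. \<lbrakk>j < n; j \<noteq> i; j mod (2 * m) = i mod (2 * m); a < w ^ m\<rbrakk> \<Longrightarrow> g j a = 0"
    and other: "\<And>j a. \<lbrakk>j \<in> H; j mod (2 * m) \<noteq> i mod (2 * m); a < w ^ m; digit w m a (i mod m) = 0\<rbrakk>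
      \<Longrightarrow> (\<Sum>v<w. g j (set_digit w m a (i mod m) v)) = 0"
    and b: "b < w ^ m"
  shows "g i b = 0"
proof -
  let ?h = "i mod m" and ?ib = "i mod (2 * m)"
  have h: "?h < m" using m_pos by simp
  define G where "G = (\<lambda>j a. \<Sum>v<w. g j (set_digit w m a ?h v))"
  have "g i (set_digit w m a ?h u) = 0"
    if a: "a < w ^ m" "digit w m a ?h = 0" and u: "u < w" for a u
  proof (rule reduced_system_kernel[where G = G and z = "\<lambda>u a. g i (set_digit w m a ?h u)",
        OF i(1) card _ _ _ u])
    fix a t assume "a \<in> {a. a < w ^ m \<and> digit w m a ?h = 0}" and t: "t < r"
    then have a: "a < w ^ m" "digit w m a ?h = 0" by auto
    let ?F = "\<lambda>j. \<Sum>v<w. parity_row m w x lam t j (g j) (set_digit w m a ?h v)"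
    have less: "set_digit w m a ?h v < w ^ m" if "v < w" for v
      using a h that by (simp add: set_digit_less)
    have "(\<Sum>j<n. ?F j) = 0"
      by (subst sum.swap) (use eq[OF t] less in simp)
    moreover have "?F j = reduced_row i t j (G j) a" if "j mod (2 * m) \<noteq> ?ib" for j
      unfolding G_def by (rule sum_parity_rows_eq_reduced_row[OF i(2) that a])
    moreover have "?F i = (\<Sum>u<w. (x i * lam ?ib u) ^ t * g i (set_digit w m a ?h u))"
      using i(2) h unfolding parity_row_def by (simp add: digit_set_digit)
    moreover have "?F j = 0" if "j < n" "j \<noteq> i" "j mod (2 * m) = ?ib" for j
      using same[OF that] m_pos less by (intro sum.neutral ballI parity_row_0) auto
    ultimately show "(\<Sum>j | j < n \<and> j mod (2 * m) \<noteq> ?ib. reduced_row i t j (G j) a)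
        + (\<Sum>u<w. (x i * lam ?ib u) ^ t * g i (set_digit w m a ?h u)) = 0"
      using sum_nodes_split[OF i(1), of ?F] by simp
  qed (use other a in \<open>auto simp: G_def\<close>)
  then show ?thesis
    by (intro eq_0_if_digit_variants_eq_0[OF h b, of "g i"]) auto
qed

end

lemma recoverableI:
  assumes "\<And>f f'. \<lbrakk>f \<in> C; f' \<in> C; \<And>j. j \<in> H \<Longrightarrow> R i j *\<^sub>v f j = R i j *\<^sub>v f' j\<rbrakk> \<Longrightarrow> f i = f' i"
  shows "recoverable C R i H"
proof -
  let ?data = "\<lambda>f. \<lambda>j\<in>H. R i j *\<^sub>v f j"
  \<comment> \<open>The decoder chooses any codeword consistent with the data and reads off its
    component \<open>i\<close>; consistent codewords agree there by assumption.\<close>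
  define dec where "dec = (\<lambda>y. (SOME f. f \<in> C \<and> ?data f = y) i)"
  have "f i = dec (?data f)" if "f \<in> C" for f
  proof -
    define f' where "f' = (SOME f'. f' \<in> C \<and> ?data f' = ?data f)"
    have f': "f' \<in> C \<and> ?data f' = ?data f"
      unfolding f'_def by (rule someI[where x = f]) (simp add: that)
    have "f i = f' i"
    proof (rule assms[OF that conjunct1[OF f']])
      show "R i j *\<^sub>v f j = R i j *\<^sub>v f' j" if "j \<in> H" for j
        using fun_cong[OF conjunct2[OF f'], of j] that by simp
    qed
    then show ?thesis
      unfolding dec_def f'_def .
  qed
  then show ?thesis
    unfolding recoverable_def by blast
qed

lemma C1_repair_same:
  "j mod (2 * m) = i mod (2 * m) \<Longrightarrow> C1_repair m w i j = 1\<^sub>m (w ^ m)"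
  by (simp add: C1_repair_def Let_def)

lemma C1_repair_other_carrier:
  assumes "j mod (2 * m) \<noteq> i mod (2 * m)" "0 < w"
  shows "C1_repair m w i j \<in> carrier_mat (w ^ (m - 1)) (w ^ m)"
  using assms V_mat_carrier[of "i mod (2 * m)" m 0 w] by (auto simp: C1_repair_def Let_def)

text \<open>Row \<open>p\<close> corresponds to the \<open>p\<close>-th index with digit 0. In the
  summed matrix the rows number \<open>p\<close> select all digit variants of that index, so the
  product is a sum over the digit.\<close>

lemma C1_repair_mult_vec:
  fixes v :: "'a::field vec"
  assumes "j mod (2 * m) \<noteq> i mod (2 * m)" "0 < w" "0 < m" "p < w ^ (m - 1)"
    and v: "v \<in> carrier_vec (w ^ m)"
  shows "(C1_repair m w i j *\<^sub>v v) $ p =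
    (if i mod (2 * m) < m then v $ (digit_list w m (i mod m) 0 ! p)
     else \<Sum>u<w. v $ set_digit w m (digit_list w m (i mod m) 0 ! p) (i mod m) u)"
proof -
  let ?R = "C1_repair m w i j :: 'a mat" and ?L = "\<lambda>u. digit_list w m (i mod m) u ! p"
  have h: "i mod m < m" and ib: "i mod (2 * m) < 2 * m" "i mod (2 * m) mod m = i mod m"
    using assms by (simp_all add: mod_mod_cancel)
  have R: "?R \<in> carrier_mat (w ^ (m - 1)) (w ^ m)"
    by (rule C1_repair_other_carrier[OF assms(1,2)])
  have mult: "(?R *\<^sub>v v) $ p = (\<Sum>c<w ^ m. ?R $$ (p, c) * v $ c)"
    using v assms(4) R by (auto simp: scalar_prod_def atLeast0LessThan intro!: sum.cong)
  have V: "V_mat m w (i mod (2 * m)) u $$ (p, c) = (if c = ?L u then 1 else 0)"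
    if "u < w" "c < w ^ m" for u c
    using index_V_mat[OF ib(1) that(1) assms(4) that(2)] ib(2) by simp
  have L: "?L u < w ^ m" if "u < w" for u
    using digit_list_nth_less[OF h that assms(4)] .
  show ?thesis
  proof (cases "i mod (2 * m) < m")
    case True
    then have "(?R *\<^sub>v v) $ p = (\<Sum>c<w ^ m. if c = ?L 0 then v $ c else 0)"
      unfolding mult using assms(1,2) by (intro sum.cong) (auto simp: C1_repair_def Let_def V)
    then show ?thesis
      using True L[OF assms(2)] by simp
  next
    case False
    then have "(?R *\<^sub>v v) $ p = (\<Sum>c<w ^ m. (\<Sum>u<w. if c = ?L u then 1 else 0) * v $ c)"
      unfolding mult using assms(1,2,4) by (intro sum.cong) (auto simp: C1_repair_def Let_def V)
    also have "\<dots> = (\<Sum>u<w. \<Sum>c<w ^ m. if c = ?L u then v $ c else 0)"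
      unfolding sum_distrib_right by (subst sum.swap) (intro sum.cong refl, simp)
    also have "\<dots> = (\<Sum>u<w. v $ ?L u)"
      using L by simp
    also have "\<dots> = (\<Sum>u<w. v $ set_digit w m (?L 0) (i mod m) u)"
    proof (rule sum.cong[OF refl])
      fix u assume "u \<in> {..<w}"
      then show "v $ ?L u = v $ set_digit w m (?L 0) (i mod m) u"
        by (subst digit_list_nth[OF h _ assms(4)]) auto
    qed
    finally show ?thesis
      using False by simp
  qed
qed

context C1_conditions
begin

text \<open>By linearity the kernel lemmas apply to the difference \<open>g\<close> of two codewords
  with equal data. The assumptions \<open>d\<close> say that at most \<open>n - k - w\<close> nodes
  besides \<open>i\<close> are not contacted, leaving room for the \<open>w\<close> unknowns of node
  \<open>i\<close>.\<close>

theorem recoverable_C1: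
  assumes i: "i < n" and H: "H \<in> admissible_helpers n (2 * m) d i"
    and d: "n \<le> d + 1 + (n - k) - w" "w \<le> n - k"
  shows "recoverable (array_code n k (w ^ m) (C1_parity m w x lam)) (C1_repair m w) i H"
proof (rule recoverableI)
  let ?C = "array_code n k (w ^ m) (C1_parity m w x lam)" and ?R = "C1_repair m w :: nat \<Rightarrow> nat \<Rightarrow> 'a mat"
  have Hsub: "H \<subseteq> {..<n} - {i}" and Hcard: "card H = d"
    and Hcomp: "compulsory_helpers n (2 * m) i \<subseteq> H"
    using H unfolding admissible_helpers_def by auto
  have finH: "finite H" using Hsub finite_subset by blast
  fix f f' assume f: "f \<in> ?C" and f': "f' \<in> ?C"
    and data: "\<And>j. j \<in> H \<Longrightarrow> ?R i j *\<^sub>v f j = ?R i j *\<^sub>v f' j"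
  have car: "f j \<in> carrier_vec (w ^ m)" "f' j \<in> carrier_vec (w ^ m)" if "j < n" for j
    using f f' that unfolding array_code_def by auto
  define g where "g = (\<lambda>j a. f j $ a - f' j $ a)"
  have h: "i mod m < m" using m_pos by simp
  have card: "card ({j. j < n \<and> j mod (2 * m) \<noteq> i mod (2 * m)} - H) + w \<le> n - k"
  proof -
    have "card ({j. j < n \<and> j mod (2 * m) \<noteq> i mod (2 * m)} - H) \<le> card ({..<n} - {i} - H)"
      by (intro card_mono) auto
    also have "\<dots> = n - 1 - d"
      using Hsub finH i by (simp add: card_Diff_subset Hcard)
    finally show ?thesis using d by linarith
  qed
  have eq: "(\<Sum>j<n. parity_row m w x lam t j (g j) a) = 0" if "t < n - k" "a < w ^ m" for t a
    unfolding g_def parity_row_diff sum_subtractf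
    using array_code_parity_row[OF m_pos w_pos f that] array_code_parity_row[OF m_pos w_pos f' that]
    by simp
  have same: "g j a = 0" if "j < n" "j \<noteq> i" "j mod (2 * m) = i mod (2 * m)" "a < w ^ m" for j a
  proof -
    have "j \<in> H" using that Hcomp unfolding compulsory_helpers_def by auto
    from data[OF this] show ?thesis
      using car[OF that(1)] that unfolding g_def by (simp add: C1_repair_same)
  qed
  have other: "if i mod (2 * m) < m then g j a = 0
      else (\<Sum>v<w. g j (set_digit w m a (i mod m) v)) = 0"
    if ja: "j \<in> H" "j mod (2 * m) \<noteq> i mod (2 * m)" "a < w ^ m" "digit w m a (i mod m) = 0" for j a
  proof -
    \<comment> \<open>Every index with zero digit occurs in the list, so some component of the
      downloaded data speaks about \<open>a\<close>.\<close>
    obtain p where p: "p < w ^ (m - 1)" "digit_list w m (i mod m) 0 ! p = a"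
      by (rule digit_list_0_nthE[OF h w_pos ja(3,4)])
    have j: "j < n" using ja(1) Hsub by auto
    from data[OF ja(1)] have "(?R i j *\<^sub>v f j) $ p = (?R i j *\<^sub>v f' j) $ p"
      by simp
    then show ?thesis
      using C1_repair_mult_vec[OF ja(2) w_pos m_pos p(1) car(1)[OF j]]
        C1_repair_mult_vec[OF ja(2) w_pos m_pos p(1) car(2)[OF j]] p(2)
      unfolding g_def by (simp add: sum_subtractf split: if_splits)
  qed
  have "g i b = 0" if "b < w ^ m" for b
  proof (cases "i mod (2 * m) < m")
    case True
    show ?thesis
      by (rule repair_kernel_lower[OF i True card eq same _ that]) (use other True in auto)
  next
    case False
    show ?thesis
      by (rule repair_kernel_upper[OF i False card eq same _ that]) (use other False in auto)
  qed
  then show "f i = f' i"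
    using car[OF i] by (intro eq_vecI) (auto simp: g_def)
qed

end

subsection \<open>Repair bandwidth\<close>

text \<open>The residue class of \<open>i\<close> consists of the numbers
  \<open>q * b + i mod b\<close> with \<open>q < s\<close>, and \<open>i\<close> itself is
  removed.\<close>

lemma card_compulsory_helpers:
  assumes "i < s * b"
  shows "card (compulsory_helpers (s * b) b i) = s - 1"
proof -
  have b: "0 < b" using assms by (cases b) auto
  have "{j. j < s * b \<and> j mod b = i mod b} = (\<lambda>q. q * b + i mod b) ` {..<s}"
  proof (intro equalityI subsetI)
    fix j assume "j \<in> {j. j < s * b \<and> j mod b = i mod b}"
    then show "j \<in> (\<lambda>q. q * b + i mod b) ` {..<s}"
      by (intro image_eqI[of _ _ "j div b"]) (auto simp: less_mult_imp_div_less dest: sym)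
  next
    fix j assume "j \<in> (\<lambda>q. q * b + i mod b) ` {..<s}"
    then obtain q where q: "q < s" "j = q * b + i mod b" by auto
    have "q * b + i mod b < q * b + b" using b by simp
    also have "\<dots> \<le> s * b"
      using q(1) mult_right_mono[of "q + 1" s b] by simp
    finally show "j \<in> {j. j < s * b \<and> j mod b = i mod b}"
      using q by simp
  qed
  moreover have "inj_on (\<lambda>q. q * b + i mod b) {..<s}"
    using b by (auto simp: inj_on_def)
  ultimately have "card {j. j < s * b \<and> j mod b = i mod b} = s"
    by (simp add: card_image)
  moreover have "compulsory_helpers (s * b) b i = {j. j < s * b \<and> j mod b = i mod b} - {i}"
    unfolding compulsory_helpers_def by auto
  ultimately show ?thesis
    using assms by (simp add: card_Diff_singleton)
qed

text \<open>Compulsory helpers send their whole content through the identity matrix; the repair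
  matrices of the remaining \<open>d - dc\<close> helpers have \<open>w ^ (m - 1)\<close>
  rows.\<close>

lemma repair_bandwidth_C1_le:
  assumes "0 < w" and H: "H \<in> admissible_helpers n (2 * m) d i"
    and dc: "card (compulsory_helpers n (2 * m) i) = dc"
  shows "repair_bandwidth (C1_repair m w :: nat \<Rightarrow> nat \<Rightarrow> 'a::field mat) i H
    \<le> dc * w ^ m + (d - dc) * w ^ (m - 1)"
proof -
  let ?R = "C1_repair m w :: nat \<Rightarrow> nat \<Rightarrow> 'a mat" and ?K = "compulsory_helpers n (2 * m) i"
  have Hsub: "H \<subseteq> {..<n} - {i}" "card H = d" and K: "?K \<subseteq> H"
    using H unfolding admissible_helpers_def by auto
  have finH: "finite H" using Hsub finite_subset by blast
  have "repair_bandwidth ?R i H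
      = (\<Sum>j\<in>H - ?K. mat_rank (?R i j)) + (\<Sum>j\<in>?K. mat_rank (?R i j))"
    unfolding repair_bandwidth_def by (rule sum.subset_diff[OF K finH])
  also have "\<dots> \<le> (\<Sum>j\<in>H - ?K. w ^ (m - 1)) + (\<Sum>j\<in>?K. w ^ m)"
  proof (intro add_mono sum_mono)
    fix j assume "j \<in> H - ?K"
    then have "j mod (2 * m) \<noteq> i mod (2 * m)"
      using Hsub unfolding compulsory_helpers_def by auto
    then have "?R i j \<in> carrier_mat (w ^ (m - 1)) (w ^ m)"
      using assms(1) by (rule C1_repair_other_carrier)
    then show "mat_rank (?R i j) \<le> w ^ (m - 1)"
      using mat_rank_le_dim_row[of "?R i j"] by auto
  next
    fix j assume "j \<in> ?K"
    then have "j mod (2 * m) = i mod (2 * m)"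
      unfolding compulsory_helpers_def by auto
    then show "mat_rank (?R i j) \<le> w ^ m"
      using mat_rank_le_dim_row[of "?R i j"] by (simp add: C1_repair_same)
  qed
  also have "\<dots> = dc * w ^ m + (d - dc) * w ^ (m - 1)"
    using card_Diff_subset[OF finite_subset[OF K finH] K] Hsub dc by simp
  finally show ?thesis .
qed

lemma near_optimal_bandwidth_C1:
  assumes "0 < w" "0 < m" "0 < d" "d = k + w - 1" "dc \<le> d"
    and dc: "\<And>i. i < n \<Longrightarrow> card (compulsory_helpers n (2 * m) i) = dc"
  shows "near_optimal_bandwidth n k (2 * m) (w ^ m) d
    (real dc * (real d - real k) / real d) (C1_repair m w :: nat \<Rightarrow> nat \<Rightarrow> 'a::field mat)"
  unfolding near_optimal_bandwidth_def
proof (intro allI impI ballI)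
  fix i H assume "i < n" and H: "H \<in> admissible_helpers n (2 * m) d i"
  let ?M = "w ^ (m - 1)"
  have N: "w ^ m = w * ?M"
    using assms(2) by (simp flip: power_Suc)
  have k: "real d - real k + 1 = real w" "real d - real k = real w - 1"
    using assms(1,4) by auto
  have "real (repair_bandwidth (C1_repair m w :: nat \<Rightarrow> nat \<Rightarrow> 'a mat) i H)
      \<le> real (dc * w ^ m + (d - dc) * ?M)"
    using repair_bandwidth_C1_le[OF assms(1) H dc[OF \<open>i < n\<close>]] by (rule of_nat_mono)
  \<comment> \<open>Both sides of the bound reduce to this form because \<open>d - k + 1 = w\<close>
    and \<open>w ^ m = w * ?M\<close>.\<close>
  also have "\<dots> = (real d + real dc * (real w - 1)) * real ?M"
    unfolding N of_nat_add of_nat_mult of_nat_diff[OF assms(5)] by (simp add: algebra_simps)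
  also have "\<dots> = (1 + real dc * (real d - real k) / real d) * (real d / (real d - real k + 1))
      * real (w ^ m)"
    unfolding k N using assms(1,3) by (simp add: field_simps)
  finally show "real (repair_bandwidth (C1_repair m w :: nat \<Rightarrow> nat \<Rightarrow> 'a mat) i H)
      \<le> (1 + real dc * (real d - real k) / real d) * (real d / (real d - real k + 1))
        * real (w ^ m)" .
qed

theorem theorem3:
  fixes m s w r nbar kbar dbar N n k d dc :: nat
    and x :: "nat \<Rightarrow> 'a::{field,finite}"
    and lam :: "nat \<Rightarrow> nat \<Rightarrow> 'a"
  assumes "m \<ge> 2" and "s \<ge> 2" and "2 \<le> w" and "w < r" and "r < nbar"
    and "nbar = 2 * m" and "kbar = nbar - r" and "dbar = kbar + w - 1"
    and "N = w ^ m" and "n = s * nbar" and "k = n - r"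
    and "d = n - nbar + dbar" and "dc = s - 1"
    and x_nonzero: "\<forall>i<n. x i \<noteq> 0"
    and cond_i: "\<forall>u<w. \<forall>u'<w. \<forall>i<n. \<forall>j<n. i mod m \<noteq> j mod m \<longrightarrow>
           x i * lam (i mod nbar) u \<noteq> x j * lam (j mod nbar) u'"
    and cond_ii: "\<forall>u<w. \<forall>i<n. \<forall>j<n. i \<noteq> j \<and> i mod m = j mod m \<longrightarrow>
           x i * lam (i mod nbar) u \<noteq> x j * lam (j mod nbar) u"
    and cond_iii: "\<forall>ibar<nbar. \<forall>u<w. \<forall>u'<w. u \<noteq> u' \<longrightarrow> lam ibar u \<noteq> lam ibar u'"
    and cond_iv: "\<forall>u\<in>{1..<w}. \<forall>i<n. \<forall>j<n. i mod m = j mod m \<and> i mod nbar \<noteq> j mod nbar \<longrightarrow>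
           x i * lam (i mod nbar) 0 \<noteq> x j * lam (j mod nbar) u"
  shows "is_MDS n k N (C1_parity m w x lam)
    \<and> repair_property n nbar d dc (array_code n k N (C1_parity m w x lam)) (C1_repair m w)
    \<and> near_optimal_bandwidth n k nbar N d
        (real dc * (real d - real k) / real d) (C1_repair m w :: nat \<Rightarrow> nat \<Rightarrow> 'a mat)"
proof -
  interpret C1_conditions m w n x lam
    using \<open>2 \<le> m\<close> \<open>2 \<le> w\<close> x_nonzero cond_i cond_ii cond_iii cond_iv unfolding \<open>nbar = 2 * m\<close>
    by unfold_locales auto
  have "s * nbar \<ge> 2 * nbar"
    using \<open>2 \<le> s\<close> by (rule mult_right_mono) simp
  \<comment> \<open>Makes the truncated subtractions in \<open>k\<close> and \<open>d\<close> exact,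
    so that \<open>d = k + w - 1\<close> and exactly \<open>n - 1 - d = r - w\<close> nodes are not
    contacted.\<close>
  then have n: "2 * nbar \<le> n" using \<open>n = s * nbar\<close> by simp
  then have d: "d = k + w - 1" and r: "n - k = r"
    using assms(3-8,11,12) by auto
  have dc: "card (compulsory_helpers n nbar i) = dc" if "i < n" for i
    using card_compulsory_helpers that unfolding \<open>n = s * nbar\<close> \<open>dc = s - 1\<close> by blast
  have "dc \<le> d"
  proof -
    \<comment> \<open>The right-hand side is \<open>n - nbar\<close>, which is at most
      \<open>d\<close>.\<close>
    have "(s - 1) * 1 \<le> (s - 1) * nbar"
      using \<open>r < nbar\<close> by (intro mult_left_mono) auto
    then have "s - 1 \<le> n - nbar"
      unfolding \<open>n = s * nbar\<close> by (simp add: diff_mult_distrib)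
    then show ?thesis
      using \<open>d = n - nbar + dbar\<close> \<open>dc = s - 1\<close> by simp
  qed
  moreover have "recoverable (array_code n k N (C1_parity m w x lam)) (C1_repair m w) i H"
    if "i < n" "H \<in> admissible_helpers n nbar d i" for i H
    unfolding \<open>N = w ^ m\<close>
    by (rule recoverable_C1[OF that(1) that(2)[unfolded \<open>nbar = 2 * m\<close>]])
       (use d r n \<open>w < r\<close> \<open>r < nbar\<close> \<open>2 \<le> w\<close> \<open>k = n - r\<close> in auto)
  moreover have "near_optimal_bandwidth n k nbar N d
      (real dc * (real d - real k) / real d) (C1_repair m w :: nat \<Rightarrow> nat \<Rightarrow> 'a mat)"
    unfolding \<open>nbar = 2 * m\<close> \<open>N = w ^ m\<close>
    using w_pos m_pos d \<open>dc \<le> d\<close> \<open>2 \<le> w\<close> dc[unfolded \<open>nbar = 2 * m\<close>]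
    by (intro near_optimal_bandwidth_C1) auto
  ultimately show ?thesis
    using is_MDS_C1 dc unfolding repair_property_def \<open>N = w ^ m\<close> by blast
qed

end
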